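(* Let $V_->V_+>0$ and $0<\rho_-<\rho_+\le\rho^*$ with $f_-(\rho_-)=f_+(\rho_+)$. Then there exists a unique monotone profile $Q:\mathbb{R}\to(0,1)$ which satisfies $$Q'(x)=\begin{cases}\dfrac{Q(x)^2}{\ell\,\phi(Q(x))}\left[\phi(Q(x))-\phi(Q(x^\sharp))\right], & x^\sharp<0\ \text{or}\ x>0,\\[2mm] \dfrac{Q(x)^2}{\ell\,V_-\phi(Q(x))}\left[V_-\phi(Q(x))-V_+\phi(Q(x^\sharp))\right], & x<0<x^\sharp,\end{cases}\qquad x^\sharp=x+\frac{\ell}{Q(x)},$$ with $$Q(x)=\rho_+\ \text{ for } x\ge0,\qquad \lim_{x\to-\infty}Q(x)=\rho_-.$$
   Context: Standing setting: $\ell>0$ is the car length. $\phi:[0,1]\to[0,1]$ is twice differentiable with $\phi'\le-\hat c_0<0$, $\phi(0)=1$, $\phi(1)=0$, and is such that $f_\pm(\rho)=V_\pm\,\rho\,\phi(\rho)$ satisfy $f_\pm''\le -c_0<0$ for some constant $c_0>0$. $\rho^*\in(0,1)$ is the unique point with $f_-'(\rho^* )=f_+'(\rho^* )=0$. Profiles $Q$ are continuous on $\mathbb{R}$, possibly with kinks; the derivative in the equation is understood as a left derivative, and the equation is not imposed at points where $x=0$ or $x^\sharp=0$. *)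

theory Defs
  imports Complex_Main "HOL-Library.FuncSet"
begin

text \<open>Functions on \<open>[0,1]\<close> are total functions \<open>real \<Rightarrow> real\<close> whose values outside \<open>[0,1]\<close> are
  irrelevant; derivatives are taken within \<open>[0,1]\<close>, hence are one-sided at the endpoints.\<close>

definition twice_deriv_unit ::
    "(real \<Rightarrow> real) \<Rightarrow> (real \<Rightarrow> real) \<Rightarrow> (real \<Rightarrow> real) \<Rightarrow> bool" where
  "twice_deriv_unit f f' f'' \<longleftrightarrow>
     (\<forall>x\<in>{0..1}. (f has_real_derivative f' x) (at x within {0..1})
               \<and> (f' has_real_derivative f'' x) (at x within {0..1}))"

definition speed_function :: "(real \<Rightarrow> real) \<Rightarrow> bool" where
  "speed_function \<phi> \<longleftrightarrow>
     \<phi> \<in> {0..1} \<rightarrow> {0..1} \<and> \<phi> 0 = 1 \<and> \<phi> 1 = 0 \<and>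
     (\<exists>\<phi>' \<phi>''. twice_deriv_unit \<phi> \<phi>' \<phi>'' \<and> (\<exists>c>0. \<forall>x\<in>{0..1}. \<phi>' x \<le> - c))"

definition flux :: "real \<Rightarrow> (real \<Rightarrow> real) \<Rightarrow> real \<Rightarrow> real" where
  "flux V \<phi> \<rho> = V * \<rho> * \<phi> \<rho>"

definition second_deriv_le :: "(real \<Rightarrow> real) \<Rightarrow> real \<Rightarrow> bool" where
  "second_deriv_le f b \<longleftrightarrow> (\<exists>f' f''. twice_deriv_unit f f' f'' \<and> (\<forall>x\<in>{0..1}. f'' x \<le> b))"

text \<open>The position \<open>x\<^sup>\<sharp>\<close> of the leader of the car located at \<open>x\<close>.\<close>

definition leader :: "real \<Rightarrow> (real \<Rightarrow> real) \<Rightarrow> real \<Rightarrow> real" where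
  "leader l Q x = x + l / Q x"

text \<open>The derivative of \<open>Q\<close> is a left derivative. No equation is imposed where \<open>x = 0\<close> or
  \<open>leader l Q x = 0\<close>; as \<open>Q > 0\<close>, every other \<open>x\<close> satisfies exactly one of the two premises.\<close>

definition profile_equation ::
    "real \<Rightarrow> real \<Rightarrow> real \<Rightarrow> (real \<Rightarrow> real) \<Rightarrow> (real \<Rightarrow> real) \<Rightarrow> bool" where
  "profile_equation l Vm Vp \<phi> Q \<longleftrightarrow>
     (\<forall>x. (leader l Q x < 0 \<or> x > 0 \<longrightarrow>
            (Q has_real_derivative
               (Q x)\<^sup>2 / (l * \<phi> (Q x)) * (\<phi> (Q x) - \<phi> (Q (leader l Q x)))) (at_left x))
        \<and> (x < 0 \<and> 0 < leader l Q x \<longrightarrow>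
            (Q has_real_derivative
               (Q x)\<^sup>2 / (l * Vm * \<phi> (Q x)) * (Vm * \<phi> (Q x) - Vp * \<phi> (Q (leader l Q x)))) (at_left x)))"

end

theory Submission imports Defs "HOL-Analysis.Analysis" begin

text \<open>All cars follow one trajectory, delayed by the headway \<open>\<tau>\<close>, which the constant profile on the
  right determines. Written in terms of the time \<open>t\<close> at which a car passes the point \<open>z t\<close>, the gap
  \<open>g t = l / Q (z t)\<close> satisfies \<open>g t = z (t + \<tau>) - z t\<close>, an integral over \<open>{t..t + \<tau>}\<close> of the speed,
  which is an increasing function of \<open>g\<close>. The integral operator is monotone, which gives a decreasing
  fixed point, and it only looks forward in time, so that the fixed point is determined
  backwards from \<open>t \<ge> 0\<close>. The limit of the gap at \<open>-\<infinity>\<close> is a root of the flux equation, hence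
  \<open>l / \<rho>\<^sub>-\<close>.\<close>

text \<open>In the position variable the delay \<open>l / Q x\<close> depends on the unknown. It
  becomes constant in time because the equation says exactly that the travel time from x to its
  leader has left derivative zero. The equation is silent at x = 0 and wherever the leader is at 0,
  and nothing tells in advance that the latter happens only once. The obstacle in uniqueness is
  therefore to show that the travel time has the same value on both sides of these points: on the
  right it is fixed by the constant density, on the left by the limit at -infinity, and the equality
  of the fluxes makes the two values agree. The jump of V at the origin is the reason for working
  with integrals instead of a differential equation for z. Concavity of the flux enters as
  injectivity of f_- on [\<rho>_-, \<rho>_+], which excludes every other limit of the gap.\<close>

section \<open>Antiderivatives, inverses of bi-Lipschitz maps, and left derivatives\<close>

lemma antiderivative_has_integral:
  fixes p :: "real \<Rightarrow> real"
  assumes "\<And>a b. p integrable_on {a..b}"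
  shows "\<exists>z. z 0 = 0 \<and> (\<forall>a b. a \<le> b \<longrightarrow> (p has_integral z b - z a) {a..b})"
proof -
  define z where "z t = (if 0 \<le> t then integral {0..t} p else - integral {t..0} p)" for t
  have split: "integral {a..c} p + integral {c..b} p = integral {a..b} p" if "a \<le> c" "c \<le> b" for a b c
    using Henstock_Kurzweil_Integration.integral_combine[OF that assms] .
  have "(p has_integral z b - z a) {a..b}" if "a \<le> b" for a b
  proof -
    have "z b - z a = integral {a..b} p"
      using split[of a 0 b] split[of 0 a b] split[of a b 0] \<open>a \<le> b\<close> by (auto simp: z_def)
    then show ?thesis
      by (simp add: assms integrable_integral)
  qed
  moreover have "z 0 = 0"
    by (simp add: z_def)
  ultimately show ?thesis by blast
qed

text \<open>The speeds and their reciprocals jump at 0, so their antiderivatives are described by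
  increments, and a derivative is recovered at each point of continuity.\<close>

lemma has_integral_increments_deriv:
  fixes p z :: "real \<Rightarrow> real"
  assumes z: "\<And>a b. a \<le> b \<Longrightarrow> (p has_integral z b - z a) {a..b}" and "isCont p t"
  shows "(z has_real_derivative p t) (at t)"
proof -
  let ?I = "{t - 1..t + 1}"
  have "continuous (at t within (?I - {})) p"
    using \<open>isCont p t\<close> continuous_at_imp_continuous_at_within by blast
  then have "((\<lambda>u. integral {t - 1..u} p) has_vector_derivative p t) (at t within ?I - {})"
    using z[of "t - 1" "t + 1"]
    by (intro integral_has_vector_derivative_continuous_at) (auto simp: has_integral_iff)
  moreover have "at t within ?I - {} = at t"
    using at_within_interior[of t ?I] by simp
  ultimately have "((\<lambda>u. integral {t - 1..u} p) has_real_derivative p t) (at t)"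
    unfolding has_real_derivative_iff_has_vector_derivative by metis
  then have "((\<lambda>u. z (t - 1) + integral {t - 1..u} p) has_real_derivative p t) (at t)"
    by (auto intro!: derivative_eq_intros)
  moreover have "\<forall>\<^sub>F u in nhds t. z (t - 1) + integral {t - 1..u} p = z u"
  proof (rule eventually_nhds_in_open[of "{t - 1<..}", THEN eventually_mono])
    fix u assume "u \<in> {t - 1<..}"
    then show "z (t - 1) + integral {t - 1..u} p = z u"
      using z[of "t - 1" u] by (simp add: has_integral_iff)
  qed auto
  ultimately show ?thesis
    using DERIV_cong_ev[of t t "\<lambda>u. z (t - 1) + integral {t - 1..u} p" z "p t" "p t"] by simp
qed

lemma has_integral_increments_bounds:
  fixes p z :: "real \<Rightarrow> real"
  assumes z: "\<And>a b. a \<le> b \<Longrightarrow> (p has_integral z b - z a) {a..b}"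
    and p: "\<And>s. c \<le> p s \<and> p s \<le> d" and "a \<le> b"
  shows "c * (b - a) \<le> z b - z a" "z b - z a \<le> d * (b - a)"
proof -
  have const: "((\<lambda>s. k) has_integral k * (b - a)) {a..b}" for k :: real
    using has_integral_const_real[of k a b] \<open>a \<le> b\<close> by (simp add: mult.commute)
  show "c * (b - a) \<le> z b - z a"
    using has_integral_le[OF const z[OF \<open>a \<le> b\<close>]] p by blast
  show "z b - z a \<le> d * (b - a)"
    using has_integral_le[OF z[OF \<open>a \<le> b\<close>] const] p by blast
qed

lemma continuous_bounded_increments:
  fixes z :: "real \<Rightarrow> real"
  assumes "\<And>a b. a \<le> b \<Longrightarrow> 0 \<le> z b - z a \<and> z b - z a \<le> d * (b - a)"
  shows "continuous_on UNIV z"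
proof (rule lipschitz_on_continuous_on)
  have "\<bar>z x - z y\<bar> \<le> \<bar>d\<bar> * \<bar>x - y\<bar>" for x y
  proof -
    have "d * \<bar>x - y\<bar> \<le> \<bar>d\<bar> * \<bar>x - y\<bar>"
      by (intro mult_right_mono) auto
    moreover have "\<bar>z x - z y\<bar> \<le> d * \<bar>x - y\<bar>"
      using assms[of x y] assms[of y x] by (cases "x \<le> y") auto
    ultimately show ?thesis by linarith
  qed
  then show "\<bar>d\<bar>-lipschitz_on UNIV z"
    by (auto simp: lipschitz_on_def dist_real_def)
qed

lemma inverse_bounded_increments:
  fixes z :: "real \<Rightarrow> real"
  assumes "0 < c"
    and z: "\<And>a b. a \<le> b \<Longrightarrow> c * (b - a) \<le> z b - z a \<and> z b - z a \<le> d * (b - a)"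
  shows "bij z" "strict_mono z" "continuous_on UNIV z" "continuous_on UNIV (inv z)"
    "strict_mono (inv z)"
proof -
  have pos: "0 \<le> c * (b - a)" if "a \<le> b" for a b
    using \<open>0 < c\<close> that by simp
  show cont: "continuous_on UNIV z"
    using z pos by (intro continuous_bounded_increments[of z d]) (meson order_trans)
  show mono: "strict_mono z"
  proof (rule strict_monoI)
    fix a b :: real assume "a < b"
    then have "0 < c * (b - a)" using \<open>0 < c\<close> by simp
    then show "z a < z b" using z[of a b] \<open>a < b\<close> by linarith
  qed
  have "\<exists>x. z x = y" for y
  proof -
    \<comment> \<open>Increments grow at rate at least \<open>c\<close>, so on either side of 0 a
      length \<open>r\<close> suffices to move the value from \<open>z 0\<close> past
      \<open>y\<close>.\<close>
    define r where "r = \<bar>y - z 0\<bar> / c"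
    have "0 \<le> r" "c * r = \<bar>y - z 0\<bar>" using \<open>0 < c\<close> by (auto simp: r_def)
    then have "z (- r) \<le> y" "y \<le> z r"
      using z[of "- r" 0] z[of 0 r] by (auto simp: abs_if split: if_splits)
    then show ?thesis
      using IVT'[of z "- r" y r] \<open>0 \<le> r\<close> continuous_on_subset[OF cont] by auto
  qed
  then show bij: "bij z"
    unfolding bij_def surj_def using strict_mono_imp_inj_on[OF mono] by metis
  have inv: "z (inv z y) = y" for y
    using bij by (simp add: bij_is_surj surj_f_inv_f)
  have le: "inv z a \<le> inv z b" if "a \<le> b" for a b
    using that inv strict_mono_less_eq[OF mono] by metis
  show "strict_mono (inv z)"
    using inv strict_mono_less[OF mono] by (intro strict_monoI) metis
  show "continuous_on UNIV (inv z)"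
  proof (rule continuous_bounded_increments)
    fix a b :: real assume "a \<le> b"
    then have "c * (inv z b - inv z a) \<le> b - a"
      using z[OF le[OF \<open>a \<le> b\<close>]] inv by simp
    then show "0 \<le> inv z b - inv z a \<and> inv z b - inv z a \<le> (1 / c) * (b - a)"
      using le[OF \<open>a \<le> b\<close>] \<open>0 < c\<close> by (simp add: field_simps)
  qed
qed

text \<open>A positive left derivative at x gives smaller values just to the left of x, so the
  minimum over the interval can only sit at \<open>a\<close>. The mean value theorem does not apply
  to derivatives known from one side.\<close>

lemma left_deriv_pos_imp_le:
  fixes f :: "real \<Rightarrow> real"
  assumes "a \<le> b" and cont: "continuous_on {a..b} f"
    and deriv: "\<And>x. a < x \<Longrightarrow> x \<le> b \<Longrightarrow> \<exists>D>0. (f has_real_derivative D) (at_left x)"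
  shows "f a \<le> f b"
proof -
  obtain x where x: "x \<in> {a..b}" "\<forall>y\<in>{a..b}. f x \<le> f y"
    using continuous_attains_inf[OF compact_Icc _ cont] \<open>a \<le> b\<close> by auto
  have "x = a"
  proof (rule ccontr)
    assume "x \<noteq> a"
    then have "a < x" using x by auto
    then obtain D where "0 < D" "(f has_real_derivative D) (at_left x)"
      using deriv x by auto
    then obtain d where "d > 0" and d: "\<And>h. 0 < h \<Longrightarrow> h < d \<Longrightarrow> f (x - h) < f x"
      using has_real_derivative_pos_inc_left[of f D x "{..<x}"] by auto
    define h where "h = min (d / 2) (x - a)"
    have "0 < h" "h < d" "x - h \<in> {a..b}"
      using \<open>d > 0\<close> \<open>a < x\<close> x by (auto simp: h_def min_def)
    then show False using d[of h] x(2) by force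
  qed
  then show ?thesis using x \<open>a \<le> b\<close> by auto
qed

text \<open>Adding a small slope \<open>e\<close> makes the left derivative positive; then
  \<open>e\<close> tends to 0, for both f and -f (the sign \<open>s\<close>). Nothing is assumed
  about the derivative at \<open>b\<close>, because intervals will end at points where no equation
  is imposed; continuity reaches that endpoint.\<close>

lemma left_deriv_zero_imp_eq:
  fixes f :: "real \<Rightarrow> real"
  assumes "a \<le> b" and cont: "continuous_on {a..b} f"
    and deriv: "\<And>x. a < x \<Longrightarrow> x < b \<Longrightarrow> (f has_real_derivative 0) (at_left x)"
  shows "f a = f b"
proof (cases "a < b")
  case True
  have le: "s * f a - e * (c - a) \<le> s * f c" if "0 < e" "a \<le> c" "c < b" for s e c :: real
  proof -
    have "s * f a + e * a \<le> s * f c + e * c"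
    proof (rule left_deriv_pos_imp_le[OF \<open>a \<le> c\<close>])
      show "continuous_on {a..c} (\<lambda>x. s * f x + e * x)"
        using \<open>c < b\<close> by (intro continuous_intros continuous_on_subset[OF cont]) auto
      fix x assume "a < x" "x \<le> c"
      then have "((\<lambda>x. s * f x + e * x) has_real_derivative e) (at_left x)"
        using \<open>c < b\<close> by (auto intro!: derivative_eq_intros deriv)
      then show "\<exists>D>0. ((\<lambda>x. s * f x + e * x) has_real_derivative D) (at_left x)"
        using \<open>0 < e\<close> by blast
    qed
    then show ?thesis by (simp add: algebra_simps)
  qed
  have le0: "s * f a \<le> s * f c" if "a \<le> c" "c < b" for s c :: real
  proof (rule field_le_epsilon)
    fix e :: real assume "0 < e"
    \<comment> \<open>The summand 1 keeps the denominator positive when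
      \<open>c = a\<close>.\<close>
    then have "0 < e / (c - a + 1)" "e / (c - a + 1) * (c - a) \<le> e"
      using \<open>a \<le> c\<close> by (auto simp: field_simps)
    then show "s * f a \<le> s * f c + e"
      using le[of "e / (c - a + 1)" c s] that by linarith
  qed
  have "f b = f a"
  proof (rule continuous_constant_on_closure[of "{a..<b}" f "f a" b])
    show "continuous_on (closure {a..<b}) f" "b \<in> closure {a..<b}"
      using cont True by auto
    fix c assume "c \<in> {a..<b}"
    then show "f c = f a"
      using le0[of c 1] le0[of c "- 1"] by simp
  qed
  then show ?thesis ..
next
  case False
  then show ?thesis using \<open>a \<le> b\<close> by simp
qed

section \<open>The gap equation in time: uniqueness, existence and limit\<close>

text \<open>\<psi> is the speed as a function of the gap, up to the factor V. \<open>gp\<close> and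
  \<open>gm\<close> are the gaps of uniform traffic on the right and on the left; their fixed-point
  equations say that a car covers its own gap in the time \<tau>.\<close>

locale gap_equation =
  fixes \<psi> :: "real \<Rightarrow> real" and Vm Vp \<tau> gp gm K :: real
  assumes Vp_pos: "0 < Vp" and Vp_less_Vm: "Vp < Vm" and tau_pos: "0 < \<tau>"
    and gp_less_gm: "gp < gm" and K_pos: "0 < K" and psi_pos: "0 < \<psi> gp"
    and psi_mono: "\<And>a b. gp \<le> a \<Longrightarrow> a \<le> b \<Longrightarrow> b \<le> gm \<Longrightarrow> \<psi> a \<le> \<psi> b"
    and psi_lipschitz: "\<And>a b. a \<in> {gp..gm} \<Longrightarrow> b \<in> {gp..gm} \<Longrightarrow> \<bar>\<psi> a - \<psi> b\<bar> \<le> K * \<bar>a - b\<bar>"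
    and gp_fixed: "\<tau> * Vp * \<psi> gp = gp" and gm_fixed: "\<tau> * Vm * \<psi> gm = gm"
    and gm_unique: "\<And>a. a \<in> {gp..gm} \<Longrightarrow> \<tau> * Vm * \<psi> a = a \<Longrightarrow> a = gm"
begin

text \<open>The argument is a time in this locale and a position in \<open>bottleneck\<close>. The
  two uses agree because the increasing trajectory passes the origin at time 0.\<close>

definition V :: "real \<Rightarrow> real" where
  "V s = (if s < 0 then Vm else Vp)"

definition speed :: "(real \<Rightarrow> real) \<Rightarrow> real \<Rightarrow> real" where
  "speed g s = V s * \<psi> (g s)"

text \<open>All cars follow one trajectory \<open>z\<close>, each a time \<open>\<tau>\<close> behind its leader, and \<open>g\<close> is the
  distance to the leader.\<close>

definition trajectory :: "(real \<Rightarrow> real) \<Rightarrow> (real \<Rightarrow> real) \<Rightarrow> bool" where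
  "trajectory g z \<longleftrightarrow> z 0 = 0 \<and> (\<forall>a b. a \<le> b \<longrightarrow> (speed g has_integral z b - z a) {a..b}) \<and>
     (\<forall>t. g t = z (t + \<tau>) - z t) \<and> (\<forall>t. g t \<in> {gp..gm}) \<and> (\<forall>t\<ge>0. g t = gp)"

lemma V_bounds: "Vp \<le> V s" "V s \<le> Vm" "0 < V s"
  using Vp_pos Vp_less_Vm by (auto simp: V_def)

lemma psi_bounds: "a \<in> {gp..gm} \<Longrightarrow> \<psi> gp \<le> \<psi> a \<and> \<psi> a \<le> \<psi> gm \<and> 0 < \<psi> a"
  using psi_mono[of gp a] psi_mono[of a gm] psi_pos by auto

lemma speed_bounds:
  assumes "g s \<in> {gp..gm}"
  shows "Vp * \<psi> gp \<le> speed g s" "speed g s \<le> Vm * \<psi> gm" "0 < speed g s"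
  unfolding speed_def using V_bounds[of s] psi_bounds[OF assms] psi_pos Vp_pos
  by (auto intro!: mult_mono mult_pos_pos)

text \<open>If two gaps agree from time s on, the integral equation contracts their distance on a
  short interval before s, so they agree there too. The interval length does not depend on s, hence
  finitely many such steps backwards from 0 reach any time.\<close>

lemma trajectory_unique:
  assumes g: "trajectory g z" and h: "trajectory h w"
  shows "g = h" "z = w"
proof -
  \<comment> \<open>The bound \<tau> places \<open>t + \<tau>\<close> in the region of agreement for
    every t in the interval; the other bound makes the contraction factor 1/2.\<close>
  define \<delta> where "\<delta> = min \<tau> (1 / (2 * (Vm * K)))"
  have VK: "0 < Vm * K" using Vp_pos Vp_less_Vm K_pos by simp
  then have delta: "0 < \<delta>" "\<delta> \<le> \<tau>" "Vm * K * \<delta> \<le> 1 / 2"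
    using tau_pos by (auto simp: \<delta>_def min_def field_simps)
  have range: "g t \<in> {gp..gm}" "h t \<in> {gp..gm}" for t
    using g h by (auto simp: trajectory_def)
  have diff: "((\<lambda>s. speed g s - speed h s) has_integral (z b - w b) - (z a - w a)) {a..b}"
    if "a \<le> b" for a b
    using has_integral_diff[of "speed g" "z b - z a" "{a..b}" "speed h" "w b - w a"] g h that
    by (auto simp: trajectory_def algebra_simps)
  have eq_zw: "z b - w b = z a - w a" if "a \<le> b" "\<And>t. a \<le> t \<Longrightarrow> g t = h t" for a b
  proof -
    have "((\<lambda>s. speed g s - speed h s) has_integral 0) {a..b}"
      by (rule has_integral_is_0) (auto simp: speed_def that)
    then show ?thesis using has_integral_unique[OF diff[OF \<open>a \<le> b\<close>]] by force
  qed
  have step: "g t = h t" if s: "\<And>t. s \<le> t \<Longrightarrow> g t = h t" and "s - \<delta> \<le> t" for s t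
  proof -
    let ?D = "\<lambda>t. \<bar>g t - h t\<bar>" and ?I = "{s - \<delta>..s}"
    define M where "M = (SUP t\<in>?I. ?D t)"
    have bdd: "bdd_above (?D ` ?I)"
    proof (rule bdd_aboveI2)
      fix t show "?D t \<le> gm - gp" using range[of t] by auto
    qed
    have upper: "?D t \<le> M" if "t \<in> ?I" for t
      unfolding M_def using cSUP_upper[OF that bdd] .
    have "0 \<le> M" using upper[of s] delta by auto
    have half: "?D t \<le> M / 2" if t: "t \<in> ?I" for t
    proof -
      \<comment> \<open>Beyond s the difference of the trajectories is constant, so only the
        integral over \<open>{t..s}\<close> contributes to the difference of the gaps.\<close>
      have "z (t + \<tau>) - w (t + \<tau>) = z s - w s"
        using eq_zw[of s "t + \<tau>"] s t delta by auto
      moreover have "\<bar>(z s - w s) - (z t - w t)\<bar> \<le> (Vm * K * M) * (s - t)"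
      proof -
        have "norm (speed g r - speed h r) \<le> Vm * K * M" if "r \<in> {t..s} - {}" for r
        proof -
          have "\<bar>speed g r - speed h r\<bar> = V r * \<bar>\<psi> (g r) - \<psi> (h r)\<bar>"
            using V_bounds[of r] by (simp add: speed_def abs_mult flip: right_diff_distrib)
          also have "\<dots> \<le> Vm * (K * ?D r)"
            using V_bounds[of r] psi_lipschitz[OF range] by (intro mult_mono) auto
          also have "\<dots> \<le> Vm * (K * M)"
            using upper[of r] that t VK K_pos Vp_pos Vp_less_Vm by (intro mult_left_mono) auto
          finally show ?thesis by (simp add: mult.assoc)
        qed
        then show ?thesis
          using has_integral_bound_real[of "Vm * K * M" "{}" "\<lambda>s. speed g s - speed h s" _ t s] diff[of t s] t VK \<open>0 \<le> M\<close>
          by auto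
      qed
      moreover have "(Vm * K * M) * (s - t) \<le> (Vm * K * M) * \<delta>"
        using t VK \<open>0 \<le> M\<close> by (intro mult_left_mono) auto
      moreover have "(Vm * K * \<delta>) * M \<le> 1 / 2 * M"
        using delta \<open>0 \<le> M\<close> by (intro mult_right_mono)
      moreover have "g t - h t = (z (t + \<tau>) - w (t + \<tau>)) - (z t - w t)"
        using g h by (auto simp: trajectory_def)
      ultimately show ?thesis by (simp add: mult_ac)
    qed
    have "M \<le> M / 2"
      unfolding M_def using half delta by (intro cSUP_least) (auto simp: M_def)
    then have "M = 0" using \<open>0 \<le> M\<close> by simp
    then show ?thesis
      using upper[of t] s[of t] \<open>s - \<delta> \<le> t\<close> by (cases "s \<le> t") auto
  qed
  have "\<forall>t\<ge>- (of_nat n * \<delta>). g t = h t" for n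
  proof (induction n)
    case 0
    then show ?case using g h by (auto simp: trajectory_def)
  next
    case (Suc n)
    show ?case
    proof (intro allI impI)
      fix t assume "- (of_nat (Suc n) * \<delta>) \<le> t"
      then show "g t = h t"
        using step[of "- (of_nat n * \<delta>)" t] Suc.IH by (simp add: algebra_simps)
    qed
  qed
  moreover have "\<exists>n. - (of_nat n * \<delta>) \<le> t" for t
    using reals_Archimedean3[OF \<open>0 < \<delta>\<close>, rule_format, of "- t"] by (metis less_imp_le minus_le_iff minus_minus)
  ultimately have gh: "g t = h t" for t
    by blast
  then show "g = h" by blast
  have "z t = w t" for t
  proof -
    have "z 0 = 0" "w 0 = 0" using g h by (auto simp: trajectory_def)
    then show ?thesis using eq_zw[of t 0] eq_zw[of 0 t] gh by (cases "t \<le> 0") auto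
  qed
  then show "z = w" by blast
qed

lemma trajectory_inj:
  assumes "trajectory g z"
  shows "inj z"
proof (rule linorder_injI)
  fix a b :: real assume "a < b"
  have "Vp * \<psi> gp * (b - a) \<le> z b - z a"
    using has_integral_increments_bounds(1)[of "speed g" z] speed_bounds(1,2)[of g] assms \<open>a < b\<close>
    unfolding trajectory_def by (metis less_imp_le)
  moreover have "0 < Vp * \<psi> gp * (b - a)" using \<open>a < b\<close> Vp_pos psi_pos by simp
  ultimately show "z a \<noteq> z b" by simp
qed

text \<open>The sign of the jump enters here: V drops at 0, so it decreases together with \<psi> of
  a decreasing gap.\<close>

lemma speed_antimono:
  assumes "antimono g" and range: "\<And>s. g s \<in> {gp..gm}"
  shows "antimono (speed g)"
proof (rule antimonoI)
  fix s t :: real assume "s \<le> t"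
  then have "g t \<le> g s" using antimonoD[OF \<open>antimono g\<close>] by blast
  then have "\<psi> (g t) \<le> \<psi> (g s)" using psi_mono range[of s] range[of t] by auto
  moreover have "V t \<le> V s" using \<open>s \<le> t\<close> Vp_less_Vm by (auto simp: V_def)
  ultimately show "speed g t \<le> speed g s"
    unfolding speed_def using V_bounds[of s] V_bounds[of t] psi_bounds[OF range[of t]] by (intro mult_mono) auto
qed

text \<open>Monotonicity supplies integrability, since the supremum in the fixed-point argument
  comes without any continuity.\<close>

lemma speed_integrable:
  assumes "antimono g" and "\<And>s. g s \<in> {gp..gm}"
  shows "speed g integrable_on {a..b}"
proof -
  have "mono_on {a..b} (\<lambda>s. - speed g s)"
    using antimonoD[OF speed_antimono[OF assms]] by (auto intro: mono_onI)
  then have "(\<lambda>s. - speed g s) integrable_on {a..b}"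
    by (rule integrable_on_mono_on)
  then show ?thesis using integrable_neg by fastforce
qed

definition gap_operator :: "(real \<Rightarrow> real) \<Rightarrow> real \<Rightarrow> real" where
  "gap_operator g t = integral {t..t + \<tau>} (speed g)"

definition admissible :: "(real \<Rightarrow> real) set" where
  "admissible = {g. antimono g \<and> (\<forall>t. g t \<in> {gp..gm}) \<and> (\<forall>t\<ge>0. g t = gp)}"

text \<open>The equation for \<open>gp\<close> reproduces the constant gap at nonnegative times, and
  the two equations together keep the range. Monotonicity follows by translating the later window of
  integration onto the earlier one, where the speed is at least as large.\<close>

lemma gap_operator_admissible:
  assumes "g \<in> admissible"
  shows "gap_operator g \<in> admissible"
proof -
  have g: "antimono g" "\<And>s. g s \<in> {gp..gm}" "\<And>t. 0 \<le> t \<Longrightarrow> g t = gp"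
    using assms by (auto simp: admissible_def)
  note int = speed_integrable[OF g(1,2)]
  have const: "((\<lambda>s. k) has_integral \<tau> * k) {t..t + \<tau>}" for k t :: real
    using has_integral_const_real[of k t "t + \<tau>"] tau_pos by simp
  have "gap_operator g t = gp" if "0 \<le> t" for t
  proof -
    have "integral {t..t + \<tau>} (speed g) = integral {t..t + \<tau>} (\<lambda>s. Vp * \<psi> gp)"
      using that g(3) by (intro Henstock_Kurzweil_Integration.integral_cong) (auto simp: speed_def V_def)
    then show ?thesis
      using integral_unique[OF const] gp_fixed tau_pos by (simp add: gap_operator_def mult_ac)
  qed
  moreover have "gap_operator g t \<in> {gp..gm}" for t
  proof -
    have "\<tau> * (Vp * \<psi> gp) \<le> gap_operator g t" "gap_operator g t \<le> \<tau> * (Vm * \<psi> gm)"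
      unfolding gap_operator_def using speed_bounds(1,2)[of g, OF g(2)]
        has_integral_le[OF const integrable_integral[OF int]]
        has_integral_le[OF integrable_integral[OF int] const]
      by blast+
    then show ?thesis using gp_fixed gm_fixed by simp
  qed
  moreover have "antimono (gap_operator g)"
  proof (rule antimonoI)
    fix s t :: real assume "s \<le> t"
    have shift: "((\<lambda>r. speed g (r + (t - s))) has_integral gap_operator g t) {s..s + \<tau>}"
      using has_integral_affinity'[of "speed g" "gap_operator g t" t "t + \<tau>" 1 "t - s"]
        integrable_integral[OF int, of t "t + \<tau>"]
      by (simp add: gap_operator_def algebra_simps)
    show "gap_operator g t \<le> gap_operator g s"
      unfolding gap_operator_def[of g s]
      by (rule has_integral_le[OF shift integrable_integral[OF int]])
        (use antimonoD[OF speed_antimono[OF g(1,2)]] \<open>s \<le> t\<close> in auto)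
  qed
  ultimately show ?thesis by (auto simp: admissible_def)
qed

lemma gap_operator_mono:
  assumes "g \<in> admissible" "h \<in> admissible" "\<And>s. g s \<le> h s"
  shows "gap_operator g t \<le> gap_operator h t"
proof -
  have g: "antimono g" "\<And>s. g s \<in> {gp..gm}" and h: "antimono h" "\<And>s. h s \<in> {gp..gm}"
    using assms by (auto simp: admissible_def)
  show ?thesis unfolding gap_operator_def
  proof (rule integral_le[OF speed_integrable[OF g] speed_integrable[OF h]])
    fix s show "speed g s \<le> speed h s"
      unfolding speed_def using psi_mono assms(3)[of s] g(2)[of s] h(2)[of s] V_bounds[of s]
      by (intro mult_left_mono) auto
  qed
qed

text \<open>The supremum of the admissible \<open>g\<close> with \<open>g \<le> gap_operator g\<close> is a fixed point, as in the
  Knaster--Tarski theorem.\<close>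

lemma gap_operator_fixed_point: "\<exists>g\<in>admissible. gap_operator g = g"
proof -
  define X where "X = {g \<in> admissible. \<forall>t. g t \<le> gap_operator g t}"
  define u where "u t = (SUP g\<in>X. g t)" for t
  have const: "(\<lambda>t. gp) \<in> admissible"
    using gp_less_gm by (auto simp: admissible_def antimono_def)
  then have "(\<lambda>t. gp) \<in> X"
    using gap_operator_admissible[OF const] by (auto simp: X_def admissible_def)
  then have "X \<noteq> {}" by blast
  have range: "g t \<in> {gp..gm}" if "g \<in> X" for g t
    using that by (auto simp: X_def admissible_def)
  have bdd: "bdd_above ((\<lambda>g. g t) ` X)" for t
    using range by (intro bdd_aboveI2[of _ _ gm]) auto
  have upper: "g t \<le> u t" if "g \<in> X" for g t
    unfolding u_def using cSUP_upper[OF that bdd] .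
  have least: "u t \<le> c" if "\<And>g. g \<in> X \<Longrightarrow> g t \<le> c" for t c
    unfolding u_def using \<open>X \<noteq> {}\<close> that by (intro cSUP_least)
  have u: "u \<in> admissible"
  proof -
    have "antimono u"
    proof (intro antimonoI least)
      fix s t :: real and g assume "s \<le> t" "g \<in> X"
      then have "g t \<le> g s" by (auto simp: X_def admissible_def intro: antimonoD)
      then show "g t \<le> u s" using upper[OF \<open>g \<in> X\<close>, of s] by linarith
    qed
    moreover have "u t \<in> {gp..gm}" for t
      using upper[OF \<open>(\<lambda>t. gp) \<in> X\<close>, of t] least[of t gm] range by auto
    moreover have "u t = gp" if "0 \<le> t" for t
      unfolding u_def using \<open>X \<noteq> {}\<close> that
      by (subst SUP_cong[of X X _ "\<lambda>g. gp"]) (auto simp: X_def admissible_def)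
    ultimately show ?thesis by (auto simp: admissible_def)
  qed
  have le: "u t \<le> gap_operator u t" for t
  proof (rule least)
    fix g assume "g \<in> X"
    then have "g t \<le> gap_operator g t" "g \<in> admissible" by (auto simp: X_def)
    then show "g t \<le> gap_operator u t"
      using gap_operator_mono[OF _ u upper[OF \<open>g \<in> X\<close>], of t] by force
  qed
  have "gap_operator u \<in> X"
    using gap_operator_admissible[OF u] gap_operator_mono[OF u gap_operator_admissible[OF u] le]
    by (simp add: X_def)
  then have "gap_operator u t \<le> u t" for t by (rule upper)
  with le have "gap_operator u = u" by (intro ext antisym)
  with u show ?thesis by blast
qed

lemma trajectory_exists: "\<exists>g z. antimono g \<and> trajectory g z"
proof -
  obtain g where adm: "g \<in> admissible" and fixed: "gap_operator g = g"
    using gap_operator_fixed_point by blast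
  then have g: "antimono g" "\<And>s. g s \<in> {gp..gm}" by (auto simp: admissible_def)
  obtain z where z: "z 0 = 0" "\<And>a b. a \<le> b \<Longrightarrow> (speed g has_integral z b - z a) {a..b}"
    using antiderivative_has_integral[OF speed_integrable[OF g]] by blast
  have "g t = z (t + \<tau>) - z t" for t
    using fun_cong[OF fixed, of t] integral_unique[OF z(2)[of t "t + \<tau>"]] tau_pos
    by (simp add: gap_operator_def)
  with z adm g show ?thesis
    unfolding trajectory_def by (intro exI[of _ g] exI[of _ z]) (auto simp: admissible_def)
qed

text \<open>A window that ends before time 0 sees only the speed factor \<open>Vm\<close>, so
  monotonicity squeezes \<open>g t\<close> between \<tau> * \<open>Vm\<close> * \<psi> evaluated at
  the gaps at its two ends. Both bounds have the same limit, which makes the limit of g a solution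
  of the equation for \<open>gm\<close>.\<close>

lemma trajectory_limit:
  assumes "antimono g" and "trajectory g z"
  shows "(g \<longlongrightarrow> gm) at_bot"
proof -
  have g: "g t \<in> {gp..gm}" "g t = z (t + \<tau>) - z t" for t
    using assms(2) by (auto simp: trajectory_def)
  have z: "a \<le> b \<Longrightarrow> (speed g has_integral z b - z a) {a..b}" for a b
    using assms(2) by (auto simp: trajectory_def)
  define G where "G = (SUP t. g t)"
  have bdd: "bdd_above (range g)"
    using g by (intro bdd_aboveI2[of _ _ gm]) auto
  have upper: "g t \<le> G" for t
    unfolding G_def by (rule cSUP_upper[OF UNIV_I bdd])
  have "G \<le> gm" unfolding G_def using g by (intro cSUP_least) auto
  then have G: "G \<in> {gp..gm}" using upper[of 0] g(1)[of 0] by auto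
  have lim: "(g \<longlongrightarrow> G) at_bot"
  proof (rule increasing_tendsto)
    show "\<forall>\<^sub>F t in at_bot. g t \<le> G" using upper by simp
    fix y assume "y < G"
    then obtain t where "y < g t"
      unfolding G_def using less_cSUP_iff[OF _ bdd] by auto
    then have "y < g s" if "s \<le> t" for s
      using antimonoD[OF \<open>antimono g\<close> that] by linarith
    then show "\<forall>\<^sub>F t in at_bot. y < g t"
      unfolding eventually_at_bot_linorder by blast
  qed
  have "filterlim (\<lambda>t. t + \<tau>) at_bot at_bot"
    unfolding filterlim_at_bot eventually_at_bot_linorder by (metis le_diff_eq)
  then have lim': "((\<lambda>t. g (t + \<tau>)) \<longlongrightarrow> G) at_bot"
    using filterlim_compose[OF lim] by blast
  have psi_lim: "((\<lambda>t. \<psi> (f t)) \<longlongrightarrow> \<psi> G) at_bot"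
    if "(f \<longlongrightarrow> G) at_bot" "\<And>t. f t \<in> {gp..gm}" for f :: "real \<Rightarrow> real"
  proof -
    have "((\<lambda>t. K * \<bar>f t - G\<bar>) \<longlongrightarrow> K * \<bar>G - G\<bar>) at_bot"
      by (intro tendsto_intros that)
    then have "((\<lambda>t. K * \<bar>f t - G\<bar>) \<longlongrightarrow> 0) at_bot" by simp
    then have "((\<lambda>t. \<psi> (f t) - \<psi> G) \<longlongrightarrow> 0) at_bot"
      by (rule Lim_null_comparison[rotated]) (use psi_lipschitz[OF that(2) G] in auto)
    then show ?thesis by (simp add: LIM_zero_iff)
  qed
  have bounds: "\<tau> * Vm * \<psi> (g (t + \<tau>)) \<le> g t" "g t \<le> \<tau> * Vm * \<psi> (g t)" if "t < - \<tau>" for t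
  proof -
    have const: "((\<lambda>s. k) has_integral \<tau> * k) {t..t + \<tau>}" for k :: real
      using has_integral_const_real[of k t "t + \<tau>"] tau_pos by simp
    have int: "(speed g has_integral g t) {t..t + \<tau>}"
      using z[of t "t + \<tau>"] g(2)[of t] tau_pos by simp
    have "Vm * \<psi> (g (t + \<tau>)) \<le> speed g s" "speed g s \<le> Vm * \<psi> (g t)" if "s \<in> {t..t + \<tau>}" for s
    proof -
      have "V s = Vm" using that \<open>t < - \<tau>\<close> by (auto simp: V_def)
      moreover have "g (t + \<tau>) \<le> g s" "g s \<le> g t"
        using that antimonoD[OF \<open>antimono g\<close>] by auto
      ultimately show "Vm * \<psi> (g (t + \<tau>)) \<le> speed g s" "speed g s \<le> Vm * \<psi> (g t)"
        unfolding speed_def using psi_mono g(1)[of s] g(1)[of t] g(1)[of "t + \<tau>"] Vp_pos Vp_less_Vm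
        by (auto intro!: mult_left_mono)
    qed
    then show "\<tau> * Vm * \<psi> (g (t + \<tau>)) \<le> g t" "g t \<le> \<tau> * Vm * \<psi> (g t)"
      using has_integral_le[OF const int] has_integral_le[OF int const] by (simp_all add: mult.assoc)
  qed
  have ev: "\<forall>\<^sub>F t in at_bot. t < - \<tau>"
    by (rule eventually_gt_at_bot)
  have "((\<lambda>t. \<tau> * Vm * \<psi> (g (t + \<tau>))) \<longlongrightarrow> \<tau> * Vm * \<psi> G) at_bot"
    by (intro tendsto_intros psi_lim[OF lim' g(1)])
  then have "\<tau> * Vm * \<psi> G \<le> G"
    using tendsto_le[OF _ lim] eventually_mono[OF ev bounds(1)] by force
  moreover have "((\<lambda>t. \<tau> * Vm * \<psi> (g t)) \<longlongrightarrow> \<tau> * Vm * \<psi> G) at_bot"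
    by (intro tendsto_intros psi_lim[OF lim g(1)])
  then have "G \<le> \<tau> * Vm * \<psi> G"
    using tendsto_le[OF _ _ lim] eventually_mono[OF ev bounds(2)] by force
  ultimately have "G = gm" using gm_unique[OF G] by simp
  with lim show ?thesis by simp
qed

end

section \<open>Density profiles: translation to gaps, existence and uniqueness\<close>

text \<open>The hypotheses on \<phi> are restricted to the densities between \<open>\<rho>m\<close>
  and \<open>\<rho>p\<close>, where every profile takes its values
  (\<open>profile_mono_range\<close>).\<close>

locale bottleneck =
  fixes l Vm Vp \<rho>m \<rho>p L :: real and \<phi> :: "real \<Rightarrow> real"
  assumes l_pos: "0 < l" and Vp_pos: "0 < Vp" and Vp_less_Vm: "Vp < Vm"
    and rm_pos: "0 < \<rho>m" and rm_less_rp: "\<rho>m < \<rho>p" and rp_less_one: "\<rho>p < 1"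
    and phi_antimono: "\<And>a b. \<rho>m \<le> a \<Longrightarrow> a \<le> b \<Longrightarrow> b \<le> \<rho>p \<Longrightarrow> \<phi> b \<le> \<phi> a"
    and phi_pos: "0 < \<phi> \<rho>p" and L_pos: "0 < L"
    and phi_lipschitz: "\<And>a b. a \<in> {\<rho>m..\<rho>p} \<Longrightarrow> b \<in> {\<rho>m..\<rho>p} \<Longrightarrow> \<bar>\<phi> a - \<phi> b\<bar> \<le> L * \<bar>a - b\<bar>"
    and flux_eq: "flux Vm \<phi> \<rho>m = flux Vp \<phi> \<rho>p"
    and flux_inj: "\<And>a. a \<in> {\<rho>m..\<rho>p} \<Longrightarrow> flux Vm \<phi> a = flux Vm \<phi> \<rho>m \<Longrightarrow> a = \<rho>m"
begin

text \<open>At the constant density \<open>\<rho>p\<close> the spacing is \<open>l / \<rho>p\<close>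
  and the speed is \<open>Vp * \<phi> \<rho>p\<close>; this is their quotient.\<close>

definition headway :: real where
  "headway = l / flux Vp \<phi> \<rho>p"

lemma rp_pos: "0 < \<rho>p"
  using rm_pos rm_less_rp by simp

lemma phi_bounds: "a \<in> {\<rho>m..\<rho>p} \<Longrightarrow> \<phi> \<rho>p \<le> \<phi> a \<and> \<phi> a \<le> \<phi> \<rho>m \<and> 0 < \<phi> a"
  using phi_antimono[of \<rho>m a] phi_antimono[of a \<rho>p] phi_pos by auto

lemma flux_pos: "0 < flux Vp \<phi> \<rho>p"
  using Vp_pos rp_pos phi_pos by (simp add: flux_def)

lemma density_gap:
  assumes "a \<in> {l / \<rho>p..l / \<rho>m}"
  shows "0 < a" "l / a \<in> {\<rho>m..\<rho>p}"
proof -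
  have "0 < l / \<rho>p" using l_pos rp_pos by simp
  then show "0 < a" using assms by auto
  then show "l / a \<in> {\<rho>m..\<rho>p}"
    using assms rm_pos rp_pos by (auto simp: field_simps)
qed

lemma gap_density:
  assumes "a \<in> {\<rho>m..\<rho>p}"
  shows "l / a \<in> {l / \<rho>p..l / \<rho>m}"
  using assms rm_pos l_pos by (auto intro!: divide_left_mono mult_pos_pos)

text \<open>The map a to l / a reverses order, so \<phi> becomes increasing. Its slope has absolute
  value (l / a)^2 / l, at most \<open>\<rho>p\<^sup>2 / l\<close>, whence the Lipschitz constant.
  The equation for a gap a on the left says that the density l / a has the flux of
  \<open>\<rho>m\<close>.\<close>

sublocale gap_equation "\<lambda>a. \<phi> (l / a)" Vm Vp headway "l / \<rho>p" "l / \<rho>m" "L * \<rho>p\<^sup>2 / l"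
proof
  show "0 < Vp" "Vp < Vm" by (fact Vp_pos Vp_less_Vm)+
  show "0 < headway" using l_pos flux_pos by (simp add: headway_def)
  show "l / \<rho>p < l / \<rho>m"
    using rm_pos rm_less_rp l_pos by (simp add: divide_strict_left_mono)
  show "0 < L * \<rho>p\<^sup>2 / l" using L_pos rp_pos l_pos by simp
  show "0 < \<phi> (l / (l / \<rho>p))" using phi_pos l_pos by simp
  show "headway * Vp * \<phi> (l / (l / \<rho>p)) = l / \<rho>p"
    using flux_pos l_pos rp_pos Vp_pos phi_pos by (simp add: headway_def flux_def field_simps)
  have "Vm * \<rho>m * \<phi> \<rho>m = flux Vp \<phi> \<rho>p" using flux_eq by (simp add: flux_def)
  then show "headway * Vm * \<phi> (l / (l / \<rho>m)) = l / \<rho>m"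
    using flux_pos l_pos rm_pos by (simp add: headway_def field_simps)
next
  fix a b assume "l / \<rho>p \<le> a" "a \<le> b" "b \<le> l / \<rho>m"
  then have "a \<in> {l / \<rho>p..l / \<rho>m}" "b \<in> {l / \<rho>p..l / \<rho>m}" by auto
  then show "\<phi> (l / a) \<le> \<phi> (l / b)"
    using density_gap[of a] density_gap[of b] \<open>a \<le> b\<close> l_pos
    by (intro phi_antimono) (auto intro!: divide_left_mono mult_pos_pos)
next
  fix a b assume ab: "a \<in> {l / \<rho>p..l / \<rho>m}" "b \<in> {l / \<rho>p..l / \<rho>m}"
  have pos: "0 < a" "0 < b" using density_gap ab by blast+
  have "\<bar>\<phi> (l / a) - \<phi> (l / b)\<bar> \<le> L * \<bar>l / a - l / b\<bar>"
    using density_gap(2)[OF ab(1)] density_gap(2)[OF ab(2)] by (rule phi_lipschitz)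
  also have "l / a - l / b = (l / a) * (l / b) / l * (b - a)"
    using pos l_pos by (simp add: field_simps)
  also have "L * \<bar>(l / a) * (l / b) / l * (b - a)\<bar> = L * ((l / a) * (l / b)) / l * \<bar>a - b\<bar>"
    using pos l_pos by (simp add: abs_mult abs_minus_commute)
  also have "\<dots> \<le> L * (\<rho>p * \<rho>p) / l * \<bar>a - b\<bar>"
    using density_gap(2)[OF ab(1)] density_gap(2)[OF ab(2)] pos l_pos rm_pos L_pos
    by (intro mult_right_mono divide_right_mono mult_left_mono mult_mono) auto
  finally show "\<bar>\<phi> (l / a) - \<phi> (l / b)\<bar> \<le> L * \<rho>p\<^sup>2 / l * \<bar>a - b\<bar>"
    by (simp add: power2_eq_square)
next
  fix a assume a: "a \<in> {l / \<rho>p..l / \<rho>m}" "headway * Vm * \<phi> (l / a) = a"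
  have "0 < a" using density_gap a by blast
  have "l * (Vm * \<phi> (l / a)) = a * flux Vp \<phi> \<rho>p"
    using a(2) flux_pos by (simp add: headway_def field_simps)
  then have "flux Vm \<phi> (l / a) = flux Vm \<phi> \<rho>m"
    using \<open>0 < a\<close> flux_eq by (simp add: flux_def field_simps)
  then have "l / a = \<rho>m" using flux_inj density_gap(2)[OF a(1)] by blast
  then show "a = l / \<rho>m" using \<open>0 < a\<close> rm_pos by (simp add: field_simps)
qed

definition profile :: "(real \<Rightarrow> real) \<Rightarrow> bool" where
  "profile Q \<longleftrightarrow> (\<forall>x. 0 < Q x \<and> Q x < 1) \<and> continuous_on UNIV Q \<and> (mono Q \<or> antimono Q)
     \<and> profile_equation l Vm Vp \<phi> Q \<and> (\<forall>x\<ge>0. Q x = \<rho>p) \<and> (Q \<longlongrightarrow> \<rho>m) at_bot"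

lemma isCont_V: "s \<noteq> 0 \<Longrightarrow> isCont V s"
proof -
  assume "s \<noteq> 0"
  then have "\<forall>\<^sub>F r in nhds s. V r = V s"
    by (intro eventually_nhds_in_open[of "if s < 0 then {..<0} else {0<..}", THEN eventually_mono])
      (auto simp: V_def split: if_splits)
  then show "isCont V s"
    using isCont_cong[of V "\<lambda>r. V s" s] by simp
qed

lemma continuous_on_phi: "continuous_on {\<rho>m..\<rho>p} \<phi>"
proof (rule lipschitz_on_continuous_on)
  show "L-lipschitz_on {\<rho>m..\<rho>p} \<phi>"
    using L_pos phi_lipschitz by (auto simp: lipschitz_on_def dist_real_def)
qed

lemma continuous_phi_compose:
  assumes "continuous_on UNIV f" "\<And>x. f x \<in> {\<rho>m..\<rho>p}"
  shows "isCont (\<lambda>x. \<phi> (f x)) x"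
proof -
  have "continuous_on UNIV (\<lambda>x. \<phi> (f x))"
    using assms(2) by (intro continuous_on_compose2[OF continuous_on_phi assms(1)]) blast
  then show ?thesis by (simp add: continuous_on_eq_continuous_at)
qed

text \<open>The ratio \<open>V (leader l Q x) / V x\<close> is \<open>1\<close> in the first line of the equation and \<open>Vp / Vm\<close> in the
  second.\<close>

lemma profile_equation_iff:
  assumes "\<And>x. Q x \<in> {\<rho>m..\<rho>p}"
  shows "profile_equation l Vm Vp \<phi> Q \<longleftrightarrow>
    (\<forall>x. x \<noteq> 0 \<longrightarrow> leader l Q x \<noteq> 0 \<longrightarrow>
      (Q has_real_derivative (Q x)\<^sup>2 / l *
        (1 - V (leader l Q x) * \<phi> (Q (leader l Q x)) / (V x * \<phi> (Q x)))) (at_left x))"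
proof -
  have gt: "x < leader l Q x" for x
    using assms[of x] rm_pos l_pos by (auto simp: leader_def)
  have pos: "\<phi> (Q x) \<noteq> 0" for x using phi_bounds[OF assms[of x]] by simp
  have 1: "(Q x)\<^sup>2 / (l * \<phi> (Q x)) * (\<phi> (Q x) - \<phi> (Q (leader l Q x))) =
      (Q x)\<^sup>2 / l * (1 - V (leader l Q x) * \<phi> (Q (leader l Q x)) / (V x * \<phi> (Q x)))"
    if "leader l Q x < 0 \<or> x > 0" for x
  proof -
    have "V (leader l Q x) = V x" using that gt[of x] by (auto simp: V_def)
    then show ?thesis using V_bounds(3)[of x] pos[of x] l_pos by (simp add: field_simps)
  qed
  have 2: "(Q x)\<^sup>2 / (l * Vm * \<phi> (Q x)) * (Vm * \<phi> (Q x) - Vp * \<phi> (Q (leader l Q x))) =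
      (Q x)\<^sup>2 / l * (1 - V (leader l Q x) * \<phi> (Q (leader l Q x)) / (V x * \<phi> (Q x)))"
    if "x < 0" "0 < leader l Q x" for x
    using that pos[of x] l_pos Vp_pos Vp_less_Vm by (simp add: V_def field_simps)
  have cases: "x \<noteq> 0 \<and> leader l Q x \<noteq> 0 \<longleftrightarrow>
      (leader l Q x < 0 \<or> x > 0) \<or> (x < 0 \<and> 0 < leader l Q x)" for x
    using gt[of x] by auto
  show ?thesis
    unfolding profile_equation_def using 1 2 cases by smt
qed

text \<open>Q is the gap read as a density at the position reached, \<open>y x\<close> being the
  time at which x is passed. The leader is the same trajectory one headway later, so the ratio in
  \<open>profile_equation_iff\<close> is a quotient of two speeds and the equation is the chain
  rule. The excluded times 0 and - \<open>headway\<close> correspond to x = 0 and to a leader at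
  0.\<close>

lemma profile_exists: "\<exists>Q. profile Q"
proof -
  obtain g z where "antimono g" and gz: "trajectory g z"
    using trajectory_exists by blast
  have z0: "z 0 = 0" and z: "\<And>a b. a \<le> b \<Longrightarrow> (speed g has_integral z b - z a) {a..b}"
    and gap: "\<And>t. g t = z (t + headway) - z t"
    and range: "\<And>t. g t \<in> {l / \<rho>p..l / \<rho>m}" and right: "\<And>t. 0 \<le> t \<Longrightarrow> g t = l / \<rho>p"
    using gz unfolding trajectory_def by blast+
  define y where "y = inv z"
  have bounds: "Vp * \<phi> (l / (l / \<rho>p)) * (b - a) \<le> z b - z a \<and> z b - z a \<le> Vm * \<phi> (l / (l / \<rho>m)) * (b - a)"
    if "a \<le> b" for a b
    using has_integral_increments_bounds[of "speed g" z, OF z _ that] speed_bounds(1,2)[of g, OF range]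
    by blast
  have c: "0 < Vp * \<phi> (l / (l / \<rho>p))" using Vp_pos phi_pos l_pos by simp
  have bij: "bij z" and mono: "strict_mono z" and cont: "continuous_on UNIV z"
    and cont_y: "continuous_on UNIV y" and mono_y: "strict_mono y"
    using inverse_bounded_increments[OF c bounds] by (auto simp: y_def)
  have zy: "z (y x) = x" and yz: "y (z t) = t" for x t
    using bij by (auto simp: y_def bij_is_surj surj_f_inv_f bij_is_inj)
  have y0: "y 0 = 0" using yz[of 0] z0 by simp
  have y_less: "y x < 0 \<longleftrightarrow> x < 0" for x
    using strict_mono_less[OF mono_y, of x 0] y0 by simp
  define Q where "Q x = l / g (y x)" for x
  have Q_range: "Q x \<in> {\<rho>m..\<rho>p}" for x
    using density_gap(2)[OF range] by (simp add: Q_def)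
  have g_pos: "0 < g t" for t using density_gap(1)[OF range] .
  \<comment> \<open>Continuity of the gap was not part of the fixed-point construction; it comes
    from the gap being an increment of z.\<close>
  have cont_g: "continuous_on UNIV g"
    unfolding gap by (intro continuous_intros continuous_on_compose2[OF cont]) auto
  have leader: "leader l Q x = z (y x + headway)" for x
    using gap[of "y x"] zy[of x] l_pos g_pos[of "y x"] by (simp add: leader_def Q_def)
  have "isCont (speed g) t" if "t \<noteq> 0" for t
  proof -
    have "isCont (\<lambda>s. \<phi> (l / g s)) t"
      using density_gap[OF range]
      by (intro continuous_phi_compose continuous_intros cont_g) (auto simp: less_imp_neq[symmetric])
    then show ?thesis
      unfolding speed_def using isCont_V[OF that] by (intro continuous_intros)
  qed
  then have z_deriv: "(z has_real_derivative speed g t) (at t)" if "t \<noteq> 0" for t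
    using has_integral_increments_deriv[OF z] that by blast
  have speed_pos: "0 < speed g t" for t using speed_bounds(3)[of g, OF range] .
  have "profile_equation l Vm Vp \<phi> Q"
    unfolding profile_equation_iff[OF Q_range]
  proof (intro allI impI)
    fix x assume "x \<noteq> 0" "leader l Q x \<noteq> 0"
    define t where "t = y x"
    have t: "t \<noteq> 0" "t + headway \<noteq> 0"
      using \<open>x \<noteq> 0\<close> \<open>leader l Q x \<noteq> 0\<close> zy[of x] z0 leader[of x] by (auto simp: t_def)
    have y_deriv: "(y has_real_derivative inverse (speed g t)) (at x)"
    proof (rule has_field_derivative_inverse_basic[of z _ y x UNIV])
      show "(z has_real_derivative speed g t) (at (y x))" using z_deriv[OF t(1)] by (simp add: t_def)
      show "continuous (at x) y" using cont_y by (simp add: continuous_on_eq_continuous_at)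
    qed (use speed_pos[of t] zy in auto)
    have "((\<lambda>t. z (t + headway)) has_real_derivative speed g (t + headway)) (at t)"
      using z_deriv[OF t(2)] by (simp add: DERIV_shift)
    from DERIV_diff[OF this z_deriv[OF t(1)]]
    have "(g has_real_derivative speed g (t + headway) - speed g t) (at (y x))"
      by (simp add: gap[abs_def] t_def)
    from DERIV_chain2[OF this y_deriv]
    have "((\<lambda>x. g (y x)) has_real_derivative (speed g (t + headway) - speed g t) * inverse (speed g t)) (at x)" .
    then have "(Q has_real_derivative (0 * g (y x) - l * ((speed g (t + headway) - speed g t) * inverse (speed g t))) / (g (y x) * g (y x))) (at x)"
      unfolding Q_def[abs_def] using g_pos[of "y x"] by (intro DERIV_divide) auto
    moreover have "(0 * g (y x) - l * ((speed g (t + headway) - speed g t) * inverse (speed g t))) / (g (y x) * g (y x))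
        = (Q x)\<^sup>2 / l * (1 - speed g (t + headway) / speed g t)"
      using speed_pos[of t] l_pos g_pos[of "y x"] by (simp add: Q_def field_simps power2_eq_square)
    moreover have "speed g t = V x * \<phi> (Q x)"
      using y_less[of x] by (simp add: speed_def Q_def t_def V_def)
    moreover have "speed g (t + headway) = V (leader l Q x) * \<phi> (Q (leader l Q x))"
      using y_less[of "leader l Q x"] leader[of x] yz[of "t + headway"]
      by (simp add: speed_def Q_def t_def V_def)
    ultimately show "(Q has_real_derivative (Q x)\<^sup>2 / l *
        (1 - V (leader l Q x) * \<phi> (Q (leader l Q x)) / (V x * \<phi> (Q x)))) (at_left x)"
      by (simp add: has_field_derivative_at_within)
  qed
  moreover have "0 < Q x \<and> Q x < 1" for x
    using Q_range[of x] rm_pos rp_less_one by auto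
  moreover have "continuous_on UNIV Q"
    unfolding Q_def using g_pos
    by (intro continuous_intros continuous_on_compose2[OF cont_g cont_y]) (auto simp: less_imp_neq[symmetric])
  moreover have "mono Q"
  proof (rule monoI)
    fix a b :: real assume "a \<le> b"
    then have "g (y b) \<le> g (y a)"
      using strict_mono_less_eq[OF mono_y] antimonoD[OF \<open>antimono g\<close>] by blast
    then show "Q a \<le> Q b"
      unfolding Q_def using g_pos l_pos by (intro divide_left_mono) auto
  qed
  moreover have "Q x = \<rho>p" if "0 \<le> x" for x
    using right[of "y x"] y_less[of x] that l_pos by (simp add: Q_def)
  moreover have "(Q \<longlongrightarrow> \<rho>m) at_bot"
  proof -
    have "y x \<le> c" if "x \<le> z c" for x c
      using that strict_mono_less_eq[OF mono_y] yz by metis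
    then have "filterlim y at_bot at_bot"
      unfolding filterlim_at_bot eventually_at_bot_linorder by blast
    then have "((\<lambda>x. g (y x)) \<longlongrightarrow> l / \<rho>m) at_bot"
      using filterlim_compose[OF trajectory_limit[OF \<open>antimono g\<close> gz]] by blast
    then have "((\<lambda>x. l / g (y x)) \<longlongrightarrow> l / (l / \<rho>m)) at_bot"
      using l_pos rm_pos by (intro tendsto_intros) auto
    then show ?thesis using l_pos by (simp add: Q_def[abs_def])
  qed
  ultimately show ?thesis unfolding profile_def by blast
qed

text \<open>A decreasing profile would stay at or above \<open>\<rho>p\<close> on the left, against
  its limit \<open>\<rho>m\<close>. An increasing one lies between its limit and its value on the
  right.\<close>

lemma profile_mono_range:
  assumes "profile Q"
  shows "mono Q" "Q x \<in> {\<rho>m..\<rho>p}"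
proof -
  have Q: "\<forall>x\<ge>0. Q x = \<rho>p" "(Q \<longlongrightarrow> \<rho>m) at_bot" "mono Q \<or> antimono Q"
    using assms by (auto simp: profile_def)
  have "\<not> antimono Q"
  proof
    assume "antimono Q"
    then have "\<forall>\<^sub>F y in at_bot. \<rho>p \<le> Q y"
      using Q(1) unfolding eventually_at_bot_linorder by (metis antimonoD order_refl)
    then have "\<rho>p \<le> \<rho>m" using tendsto_lowerbound[OF Q(2)] by simp
    with rm_less_rp show False by simp
  qed
  with Q show "mono Q" by blast
  have "\<forall>\<^sub>F y in at_bot. Q y \<le> Q x"
    using monoD[OF \<open>mono Q\<close>] unfolding eventually_at_bot_linorder by blast
  then have "\<rho>m \<le> Q x" using tendsto_upperbound[OF Q(2)] by simp
  moreover have "Q x \<le> Q (max x 0)" using monoD[OF \<open>mono Q\<close>] by simp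
  ultimately show "Q x \<in> {\<rho>m..\<rho>p}" using Q(1) by simp
qed

text \<open>The time \<open>T x\<close> at which a car that crosses the origin at time \<open>0\<close> is at \<open>x\<close>. The equation
  says that the time from \<open>x\<close> to \<open>leader l Q x\<close> is locally constant as long as neither point is
  the origin. This time is \<open>headway\<close> to the right of the last and to the left of the first zero
  of the leader map, and therefore at both of these zeros; so they coincide.\<close>

lemma profile_travel_time:
  assumes "profile Q"
  obtains T where "T 0 = 0" "bij T" "strict_mono T" "continuous_on UNIV (inv T)"
    "\<And>x. x \<noteq> 0 \<Longrightarrow> (T has_real_derivative 1 / (V x * \<phi> (Q x))) (at x)"
    "\<And>x. T (leader l Q x) = T x + headway"
proof -
  have contQ: "continuous_on UNIV Q" and eqn: "profile_equation l Vm Vp \<phi> Q"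
    and right: "\<And>x. 0 \<le> x \<Longrightarrow> Q x = \<rho>p" and lim: "(Q \<longlongrightarrow> \<rho>m) at_bot"
    using assms by (auto simp: profile_def)
  note mono = profile_mono_range(1)[OF assms] and range = profile_mono_range(2)[OF assms]
  define p where "p x = 1 / (V x * \<phi> (Q x))" for x
  have phi_pos': "0 < \<phi> (Q x)" for x using phi_bounds[OF range] by blast
  have p_pos: "0 < p x" for x using phi_pos' V_bounds(3) by (simp add: p_def)
  \<comment> \<open>The time per unit length grows to the right, as V falls and Q rises. This gives
    integrability here and the squeeze of \<open>S\<close> far to the left.\<close>
  have p_mono: "p x \<le> p y" if "x \<le> y" for x y
  proof -
    have "V y \<le> V x" using that Vp_less_Vm by (auto simp: V_def)
    moreover have "\<phi> (Q y) \<le> \<phi> (Q x)"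
      using range[of x] range[of y] monoD[OF mono that] by (intro phi_antimono) auto
    ultimately show ?thesis
      unfolding p_def using V_bounds(3)[of x] V_bounds(3)[of y] phi_pos'[of x] phi_pos'[of y]
      by (intro divide_left_mono mult_mono mult_pos_pos) auto
  qed
  then have "p integrable_on {a..b}" for a b
    by (intro integrable_on_mono_on mono_onI)
  then obtain T where T0: "T 0 = 0" and T: "\<And>a b. a \<le> b \<Longrightarrow> (p has_integral T b - T a) {a..b}"
    using antiderivative_has_integral[of p] by blast
  define c d where "c = 1 / (Vm * \<phi> \<rho>m)" and "d = 1 / (Vp * \<phi> \<rho>p)"
  have Vm_phi: "0 < Vm * \<phi> \<rho>m" "0 < Vp * \<phi> \<rho>p"
    using phi_bounds[of \<rho>m] rm_less_rp Vp_pos Vp_less_Vm phi_pos by auto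
  have "c \<le> p x \<and> p x \<le> d" for x
    unfolding c_def d_def p_def
    using Vm_phi V_bounds[of x] phi_bounds[OF range[of x]] Vp_pos phi_pos
    by (intro conjI divide_left_mono mult_mono mult_pos_pos) auto
  then have T_bounds: "c * (b - a) \<le> T b - T a \<and> T b - T a \<le> d * (b - a)" if "a \<le> b" for a b
    using has_integral_increments_bounds[of p T, OF T _ that] by blast
  have "0 < c" using Vm_phi by (simp add: c_def)
  note inverse = inverse_bounded_increments[OF this T_bounds]
  have bij: "bij T" and T_mono: "strict_mono T" and contT: "continuous_on UNIV T"
    and cont_inv: "continuous_on UNIV (inv T)"
    using inverse by auto
  have "isCont p x" if "x \<noteq> 0" for x
    unfolding p_def using isCont_V[OF that] continuous_phi_compose[OF contQ range, of x] V_bounds(3)[of x] phi_pos'[of x]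
    by (intro continuous_intros) auto
  then have T_deriv: "(T has_real_derivative p x) (at x)" if "x \<noteq> 0" for x
    using has_integral_increments_deriv[of p T, OF T] that by blast
  have Q_pos: "0 < Q x" for x using range[of x] rm_pos by auto
  have cont_leader: "continuous_on UNIV (leader l Q)"
    unfolding leader_def using Q_pos by (intro continuous_intros contQ) (auto simp: less_imp_neq[symmetric])
  define S where "S x = T (leader l Q x) - T x" for x
  have contS: "continuous_on A S" for A
    unfolding S_def
    by (intro continuous_intros continuous_on_compose2[OF contT]
        continuous_on_subset[OF cont_leader] continuous_on_subset[OF contT]) auto
  have S_deriv: "(S has_real_derivative 0) (at_left x)" if x: "x \<noteq> 0" "leader l Q x \<noteq> 0" for x
  proof -
    \<comment> \<open>The equation for Q makes \<open>?r\<close> the left derivative of the leader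
      map, and \<open>?r\<close> is the quotient of \<open>p x\<close> by
      \<open>p (leader l Q x)\<close>; hence the two contributions to the derivative of
      \<open>S\<close> cancel.\<close>
    let ?r = "V (leader l Q x) * \<phi> (Q (leader l Q x)) / (V x * \<phi> (Q x))"
    have "(Q has_real_derivative (Q x)\<^sup>2 / l * (1 - ?r)) (at_left x)"
      using eqn x unfolding profile_equation_iff[OF range] by blast
    then have "(leader l Q has_real_derivative 1 + (0 * Q x - l * ((Q x)\<^sup>2 / l * (1 - ?r))) / (Q x * Q x)) (at_left x)"
      unfolding leader_def[abs_def] using Q_pos[of x] by (intro DERIV_add DERIV_divide DERIV_const DERIV_ident) auto
    moreover have "1 + (0 * Q x - l * ((Q x)\<^sup>2 / l * (1 - ?r))) / (Q x * Q x) = ?r"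
      using Q_pos[of x] l_pos by (simp add: power2_eq_square)
    ultimately have "(leader l Q has_real_derivative ?r) (at_left x)" by simp
    then have "((\<lambda>x. T (leader l Q x)) has_real_derivative p (leader l Q x) * ?r) (at_left x)"
      by (rule DERIV_chain2[of T _ "leader l Q" x, OF T_deriv[OF x(2)]])
    moreover have "p (leader l Q x) * ?r = p x"
      using phi_pos'[of "leader l Q x"] V_bounds(3)[of "leader l Q x"] by (simp add: p_def)
    ultimately have "(S has_real_derivative p x - p x) (at_left x)"
      unfolding S_def[abs_def]
      using DERIV_diff[of "\<lambda>x. T (leader l Q x)" "p x" x "{..<x}" T "p x"]
        has_field_derivative_at_within[OF T_deriv[OF x(1)]] by simp
    then show ?thesis by simp
  qed
  have S_eq: "S x = S y" if "x \<le> y" "\<And>t. x < t \<Longrightarrow> t < y \<Longrightarrow> t \<noteq> 0 \<and> leader l Q t \<noteq> 0" for x y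
    using left_deriv_zero_imp_eq[OF \<open>x \<le> y\<close> contS] S_deriv that(2) by blast

  \<comment> \<open>No equation is imposed on \<open>N\<close>, so a priori \<open>S\<close> might
    change between its first point \<open>a\<close> and its last point \<open>b\<close>.\<close>
  define N where "N = {x. leader l Q x = 0}"
  have N_sub: "N \<subseteq> {- l / \<rho>m..- l / \<rho>p}"
  proof
    fix x assume "x \<in> N"
    then have "x = - (l / Q x)" by (simp add: N_def leader_def)
    then show "x \<in> {- l / \<rho>m..- l / \<rho>p}"
      using gap_density[OF range[of x]] by simp
  qed
  have leader_right: "0 < leader l Q x" if "0 \<le> x" for x
    using that l_pos Q_pos[of x] by (simp add: leader_def add_nonneg_pos)
  have leader_left: "leader l Q x < 0" if "x < - (l / \<rho>m)" for x
    using gap_density[OF range[of x]] that by (simp add: leader_def)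
  have "compact N"
  proof -
    have "closed N"
      unfolding N_def using continuous_closed_preimage_constant[OF cont_leader, of 0] by simp
    then show ?thesis
      using N_sub bounded_closed_interval bounded_subset compact_eq_bounded_closed by blast
  qed
  have zero_between: "\<exists>t\<in>N. x \<le> t \<and> t \<le> y" if "x \<le> y" "leader l Q x \<le> 0" "0 \<le> leader l Q y" for x y
    using IVT'[of "leader l Q" x 0 y] that continuous_on_subset[OF cont_leader]
    by (auto simp: N_def)
  have lp: "0 < l / \<rho>p" "0 < l / \<rho>m" using l_pos rm_pos rp_pos by auto
  have "N \<noteq> {}"
    using zero_between[of "- (l / \<rho>m) - 1" 0] leader_left[of "- (l / \<rho>m) - 1"] leader_right[of 0] lp
    by fastforce
  obtain a where a: "a \<in> N" "\<And>t. t \<in> N \<Longrightarrow> a \<le> t"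
    using compact_attains_inf[OF \<open>compact N\<close> \<open>N \<noteq> {}\<close>] by blast
  obtain b where b: "b \<in> N" "\<And>t. t \<in> N \<Longrightarrow> t \<le> b"
    using compact_attains_sup[OF \<open>compact N\<close> \<open>N \<noteq> {}\<close>] by blast
  have neg: "t < 0" if "t \<in> N" for t using N_sub that lp by fastforce

  have "S 0 = headway"
  proof -
    have eq: "leader l Q 0 = l / \<rho>p" using right[of 0] by (simp add: leader_def)
    have "((\<lambda>x. d) has_integral T (l / \<rho>p)) {0..l / \<rho>p}"
      using has_integral_cong[of "{0..l / \<rho>p}" p "\<lambda>x. d"] T[of 0 "l / \<rho>p"] T0 lp right
      by (force simp: p_def V_def d_def)
    then have "T (l / \<rho>p) = l / \<rho>p * d"
      using has_integral_unique[OF _ has_integral_const_real[of d 0 "l / \<rho>p"]] lp by simp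
    then show ?thesis
      using eq T0 by (simp add: S_def d_def headway_def flux_def mult_ac)
  qed
  \<comment> \<open>Past \<open>b\<close> only the origin is exceptional, and continuity of
    \<open>S\<close> joins the two intervals that meet there.\<close>
  then have S_right: "S x = headway" if "b \<le> x" for x
  proof -
    have "S b = S 0" using neg[OF b(1)] b(2) by (intro S_eq) (force simp: N_def)+
    moreover have "S b = S x" if "x \<le> 0"
      using \<open>b \<le> x\<close> that b(2) by (intro S_eq) (force simp: N_def)+
    moreover have "S 0 = S x" if "0 \<le> x"
      using that leader_right[THEN less_imp_neq] by (intro S_eq) auto
    ultimately show ?thesis using \<open>S 0 = headway\<close> by (cases "x \<le> 0") auto
  qed
  have S_left_const: "S x = S a" if "x \<le> a" for x
    using that neg[OF a(1)] a(2) by (intro S_eq) (force simp: N_def)+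
  \<comment> \<open>Equality of the fluxes: uniform traffic of density \<open>\<rho>m\<close> on the
    left has the same headway as the traffic on the right.\<close>
  have c_eq: "c * (l / \<rho>m) = headway"
    unfolding headway_def flux_eq[symmetric] by (simp add: c_def flux_def mult_ac)
  have lim_c: "((\<lambda>x. 1 / (Vm * \<phi> (f x)) * (l / Q x)) \<longlongrightarrow> headway) at_bot"
    if "(f \<longlongrightarrow> \<rho>m) at_bot" "\<And>x. f x \<in> {\<rho>m..\<rho>p}" for f
  proof -
    have "((\<lambda>x. \<phi> (f x)) \<longlongrightarrow> \<phi> \<rho>m) at_bot"
      using continuous_on_tendsto_compose[OF continuous_on_phi that(1)] rm_less_rp that(2) by simp
    then have "((\<lambda>x. 1 / (Vm * \<phi> (f x)) * (l / Q x)) \<longlongrightarrow> c * (l / \<rho>m)) at_bot"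
      unfolding c_def using Vm_phi rm_pos lim by (intro tendsto_intros) auto
    then show ?thesis unfolding c_eq .
  qed
  have "leader l Q x \<le> y" if "x \<le> y - l / \<rho>m" for x y
    using gap_density[OF range[of x]] that by (simp add: leader_def)
  then have "filterlim (leader l Q) at_bot at_bot"
    unfolding filterlim_at_bot eventually_at_bot_linorder by blast
  then have lim_leader: "((\<lambda>x. Q (leader l Q x)) \<longlongrightarrow> \<rho>m) at_bot"
    using filterlim_compose[OF lim] by blast
  \<comment> \<open>When x and its leader are both left of the origin, \<open>S x\<close> is the
    distance \<open>l / Q x\<close> times a mean of \<open>p\<close>, which lies between the values
    of \<open>p\<close> at the two ends.\<close>
  have bounds: "1 / (Vm * \<phi> (Q x)) * (l / Q x) \<le> S x"
    "S x \<le> 1 / (Vm * \<phi> (Q (leader l Q x))) * (l / Q x)" if "x < - (l / \<rho>m)" for x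
  proof -
    let ?y = "leader l Q x"
    have xy: "x \<le> ?y" "?y - x = l / Q x" using Q_pos[of x] l_pos by (simp_all add: leader_def)
    have "x < 0" "?y < 0" using that lp leader_left[OF that] by auto
    then have "1 / (Vm * \<phi> (Q x)) = p x" "1 / (Vm * \<phi> (Q ?y)) = p ?y" by (auto simp: p_def V_def)
    moreover have const: "((\<lambda>t. k) has_integral k * (l / Q x)) {x..?y}" for k :: real
      using has_integral_const_real[of k x ?y] xy by (simp add: mult.commute)
    ultimately show "1 / (Vm * \<phi> (Q x)) * (l / Q x) \<le> S x" "S x \<le> 1 / (Vm * \<phi> (Q ?y)) * (l / Q x)"
      unfolding S_def using has_integral_le[OF const[of "p x"] T[OF xy(1)]]
        has_integral_le[OF T[OF xy(1)] const[of "p ?y"]] p_mono by auto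
  qed
  have ev: "\<forall>\<^sub>F x in at_bot. x < - (l / \<rho>m)"
    by (rule eventually_gt_at_bot)
  have "(S \<longlongrightarrow> headway) at_bot"
    using tendsto_sandwich[OF eventually_mono[OF ev bounds(1)] eventually_mono[OF ev bounds(2)]
        lim_c[OF lim range] lim_c[OF lim_leader range]] .
  moreover have "(S \<longlongrightarrow> S a) at_bot"
    by (rule tendsto_eventually) (use S_left_const in \<open>unfold eventually_at_bot_linorder, blast\<close>)
  ultimately have "S a = headway"
    by (rule tendsto_unique[OF trivial_limit_at_bot_linorder, rotated])
  \<comment> \<open>The leader map sends both points to 0, so \<open>S a\<close> is
    \<open>T 0 - T a\<close>, and likewise for \<open>b\<close>.\<close>
  then have "T a = T b"
    using S_right[of b] a(1) b(1) by (simp add: S_def N_def)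
  then have "a = b" using bij by (simp add: bij_is_inj inj_eq)
  then have "S x = headway" for x
    using S_right[of x] S_left_const[of x] \<open>S a = headway\<close> by (metis linear)
  then have "T (leader l Q x) = T x + headway" for x
    by (simp add: S_def diff_eq_eq add.commute)
  then show ?thesis
    by (intro that[of T] T0 bij T_mono cont_inv T_deriv[unfolded p_def])
qed

text \<open>Inverting the travel time gives the trajectory, and the constant travel time to the
  leader becomes the gap identity. The last conjunct lets Q be recovered, so that uniqueness passes
  from trajectories to profiles.\<close>

lemma profile_trajectory:
  assumes "profile Q"
  shows "\<exists>g z. trajectory g z \<and> (\<forall>x. \<exists>t. z t = x \<and> Q x = l / g t)"
proof -
  obtain T where T0: "T 0 = 0" and bij: "bij T" and mono: "strict_mono T"
    and cont: "continuous_on UNIV (inv T)"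
    and deriv: "\<And>x. x \<noteq> 0 \<Longrightarrow> (T has_real_derivative 1 / (V x * \<phi> (Q x))) (at x)"
    and leader: "\<And>x. T (leader l Q x) = T x + headway"
    using profile_travel_time[OF assms] by metis
  note range = profile_mono_range(2)[OF assms]
  have Q_pos: "0 < Q x" for x using range[of x] rm_pos by auto
  define z where "z = inv T"
  have Tz: "T (z t) = t" and zT: "z (T x) = x" for t x
    using bij by (auto simp: z_def bij_is_surj surj_f_inv_f bij_is_inj)
  have z0: "z 0 = 0" using zT[of 0] T0 by simp
  have z_less: "z t < 0 \<longleftrightarrow> t < 0" for t
    using strict_mono_less[OF mono, of "z t" 0] Tz T0 by simp
  define g where "g t = l / Q (z t)" for t
  have Qz: "Q (z t) = l / g t" for t using l_pos Q_pos[of "z t"] by (simp add: g_def)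
  have gap: "g t = z (t + headway) - z t" for t
    using leader[of "z t"] zT[of "leader l Q (z t)"] Tz by (simp add: g_def leader_def)
  have z_deriv: "(z has_real_derivative speed g t) (at t)" if "t \<noteq> 0" for t
  proof -
    have "z t \<noteq> 0" using Tz[of t] T0 that by auto
    then have "(z has_real_derivative inverse (1 / (V (z t) * \<phi> (Q (z t))))) (at t)"
      using deriv[of "z t"] V_bounds(3)[of "z t"] phi_bounds[OF range[of "z t"]] cont Tz
      by (intro has_field_derivative_inverse_basic[of T _ z t UNIV])
        (auto simp: z_def continuous_on_eq_continuous_at)
    moreover have "inverse (1 / (V (z t) * \<phi> (Q (z t)))) = speed g t"
      using z_less[of t] by (simp add: speed_def Qz V_def)
    ultimately show ?thesis by simp
  qed
  have "(speed g has_integral z b - z a) {a..b}" if "a \<le> b" for a b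
  \<comment> \<open>The speed jumps at time 0; continuity of z is enough at this single
    point.\<close>
  proof (rule fundamental_theorem_of_calculus_strong[of "{0}"])
    show "continuous_on {a..b} z" using cont continuous_on_subset by (auto simp: z_def)
    fix t assume "t \<in> {a..b} - {0}"
    then show "(z has_vector_derivative speed g t) (at t)"
      using z_deriv[of t] by (simp add: has_real_derivative_iff_has_vector_derivative)
  qed (use that in auto)
  moreover have "g t \<in> {l / \<rho>p..l / \<rho>m}" for t
    unfolding g_def by (rule gap_density[OF range])
  moreover have "g t = l / \<rho>p" if "0 \<le> t" for t
    using assms z_less[of t] that by (simp add: g_def profile_def)
  ultimately have "trajectory g z"
    unfolding trajectory_def using z0 gap by blast
  moreover have "z (T x) = x \<and> Q x = l / g (T x)" for x
    using zT[of x] Qz[of "T x"] by simp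
  ultimately show ?thesis by blast
qed

lemma profile_ex1: "\<exists>!Q. profile Q"
proof (rule ex_ex1I[OF profile_exists])
  fix Q R assume "profile Q" "profile R"
  obtain g z where g: "trajectory g z" "\<And>x. \<exists>t. z t = x \<and> Q x = l / g t"
    using profile_trajectory[OF \<open>profile Q\<close>] by blast
  obtain h w where h: "trajectory h w" "\<And>x. \<exists>t. w t = x \<and> R x = l / h t"
    using profile_trajectory[OF \<open>profile R\<close>] by blast
  have eq: "g = h" "z = w" using trajectory_unique[OF g(1) h(1)] .
  show "Q = R"
  proof
    fix x
    obtain t where t: "z t = x" "Q x = l / g t" using g(2) by blast
    obtain s where s: "z s = x" "R x = l / g s" using h(2) eq by blast
    have "s = t" using injD[OF trajectory_inj[OF g(1)]] s(1) t(1) by simp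
    then show "Q x = R x" using s t by simp
  qed
qed

end

section \<open>Consequences of the hypotheses on the speed function and the fluxes\<close>

lemma twice_deriv_unit_continuous:
  assumes "twice_deriv_unit f f' f''"
  shows "continuous_on {0..1} f" "continuous_on {0..1} f'"
proof -
  have deriv: "(f has_real_derivative f' x) (at x within {0..1})"
    "(f' has_real_derivative f'' x) (at x within {0..1})" if "x \<in> {0..1}" for x
    using assms that by (simp_all add: twice_deriv_unit_def)
  show "continuous_on {0..1} f" "continuous_on {0..1} f'"
    by (rule DERIV_continuous_on, erule deriv)+
qed

lemma twice_deriv_unit_interior:
  assumes "twice_deriv_unit f f' f''" and "0 < x" "x < 1"
  shows "(f has_real_derivative f' x) (at x)" "(f' has_real_derivative f'' x) (at x)"
proof -
  have "at x within {0..1} = at x"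
    using assms at_within_interior[of x "{0..1}"] by simp
  moreover have "(f has_real_derivative f' x) (at x within {0..1})"
    "(f' has_real_derivative f'' x) (at x within {0..1})"
    using assms by (simp_all add: twice_deriv_unit_def)
  ultimately show "(f has_real_derivative f' x) (at x)" "(f' has_real_derivative f'' x) (at x)"
    by simp_all
qed

text \<open>The first derivative strictly decreases to 0 at s, hence is positive before s. For the
  flux with factor \<open>Vm\<close> this yields \<open>flux_inj\<close>, because both densities lie
  below the critical one.\<close>

lemma concave_strict_mono_below_critical_point:
  assumes "second_deriv_le f (- c)" "0 < c" and s: "0 < s" "s < 1"
    and crit: "(f has_real_derivative 0) (at s)" and xy: "0 \<le> x" "x < y" "y \<le> s"
  shows "f x < f y"
proof -
  obtain f' f'' where f: "twice_deriv_unit f f' f''" and neg: "\<And>t. t \<in> {0..1} \<Longrightarrow> f'' t \<le> - c"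
    using assms(1) by (auto simp: second_deriv_le_def)
  have f's: "f' s = 0"
    using DERIV_unique[OF twice_deriv_unit_interior(1)[OF f s] crit] .
  have f'_pos: "0 < f' t" if t: "0 < t" "t < s" for t
  proof -
    have "f' s < f' t"
    proof (rule DERIV_neg_imp_decreasing_open[OF \<open>t < s\<close>])
      show "continuous_on {t..s} f'"
        using continuous_on_subset[OF twice_deriv_unit_continuous(2)[OF f]] t s by auto
      fix r assume "t < r" "r < s"
      then show "\<exists>y. (f' has_real_derivative y) (at r) \<and> y < 0"
        using twice_deriv_unit_interior(2)[OF f, of r] neg[of r] t s \<open>0 < c\<close> by force
    qed
    then show ?thesis using f's by simp
  qed
  show ?thesis
  proof (rule DERIV_pos_imp_increasing_open[OF \<open>x < y\<close>])
    show "continuous_on {x..y} f"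
      using continuous_on_subset[OF twice_deriv_unit_continuous(1)[OF f]] xy s by auto
    fix r assume "x < r" "r < y"
    then show "\<exists>d. (f has_real_derivative d) (at r) \<and> 0 < d"
      using twice_deriv_unit_interior(1)[OF f, of r] f'_pos[of r] xy s by force
  qed
qed

lemma speed_function_strict_antimono:
  assumes "speed_function \<phi>" "0 \<le> x" "x < y" "y \<le> 1"
  shows "\<phi> y < \<phi> x"
proof -
  obtain \<phi>' \<phi>'' c where phi: "twice_deriv_unit \<phi> \<phi>' \<phi>''" and "0 < c"
    and neg: "\<And>x. x \<in> {0..1} \<Longrightarrow> \<phi>' x \<le> - c"
    using assms(1) unfolding speed_function_def by blast
  show ?thesis
  proof (rule DERIV_neg_imp_decreasing_open[OF \<open>x < y\<close>])
    show "continuous_on {x..y} \<phi>"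
      using continuous_on_subset[OF twice_deriv_unit_continuous(1)[OF phi]] assms by auto
    fix r assume "x < r" "r < y"
    then show "\<exists>d. (\<phi> has_real_derivative d) (at r) \<and> d < 0"
      using twice_deriv_unit_interior(1)[OF phi, of r] neg[of r] assms \<open>0 < c\<close> by force
  qed
qed

text \<open>The first derivative is itself differentiable, therefore continuous and bounded on the
  compact interval.\<close>

lemma speed_function_lipschitz:
  assumes "speed_function \<phi>"
  obtains L where "0 < L" "\<And>a b. a \<in> {0..1} \<Longrightarrow> b \<in> {0..1} \<Longrightarrow> \<bar>\<phi> a - \<phi> b\<bar> \<le> L * \<bar>a - b\<bar>"
proof -
  obtain \<phi>' \<phi>'' where phi: "twice_deriv_unit \<phi> \<phi>' \<phi>''"
    using assms unfolding speed_function_def by blast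
  have "bounded (\<phi>' ` {0..1})"
    using compact_continuous_image[OF twice_deriv_unit_continuous(2)[OF phi]] compact_imp_bounded
    by blast
  then obtain L where "0 < L" and L: "\<And>x. x \<in> {0..1} \<Longrightarrow> norm (\<phi>' x) \<le> L"
    unfolding bounded_pos by blast
  have "norm (\<phi> a - \<phi> b) \<le> L * norm (a - b)" if "a \<in> {0..1}" "b \<in> {0..1}" for a b
    using phi L that unfolding twice_deriv_unit_def
    by (intro field_differentiable_bound[of "{0..1}" \<phi> \<phi>']) auto
  with \<open>0 < L\<close> show ?thesis by (intro that[of L]) auto
qed

theorem theorem3p3:
  fixes l Vm Vp \<rho>m \<rho>p \<rho>s :: real and \<phi> :: "real \<Rightarrow> real"
  assumes "l > 0"
    and "speed_function \<phi>"
    and "\<exists>c\<^sub>0>0. second_deriv_le (flux Vm \<phi>) (- c\<^sub>0) \<and> second_deriv_le (flux Vp \<phi>) (- c\<^sub>0)"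
    and "0 < \<rho>s" and "\<rho>s < 1"
    and "(flux Vm \<phi> has_real_derivative 0) (at \<rho>s)"
    and "(flux Vp \<phi> has_real_derivative 0) (at \<rho>s)"
    and "Vm > Vp" and "Vp > 0"
    and "0 < \<rho>m" and "\<rho>m < \<rho>p" and "\<rho>p \<le> \<rho>s"
    and "flux Vm \<phi> \<rho>m = flux Vp \<phi> \<rho>p"
  shows "\<exists>!Q :: real \<Rightarrow> real.
           (\<forall>x. 0 < Q x \<and> Q x < 1)
         \<and> continuous_on UNIV Q
         \<and> (mono Q \<or> antimono Q)
         \<and> profile_equation l Vm Vp \<phi> Q
         \<and> (\<forall>x\<ge>0. Q x = \<rho>p)
         \<and> (Q \<longlongrightarrow> \<rho>m) at_bot"
  proof -
  obtain L where L: "0 < L"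
    "\<And>a b. a \<in> {0..1} \<Longrightarrow> b \<in> {0..1} \<Longrightarrow> \<bar>\<phi> a - \<phi> b\<bar> \<le> L * \<bar>a - b\<bar>"
    using speed_function_lipschitz[OF assms(2)] by blast
  obtain c where c: "0 < c" "second_deriv_le (flux Vm \<phi>) (- c)"
    using assms(3) by blast
  note flux_less = concave_strict_mono_below_critical_point[OF c(2,1) assms(4,5,6)]
  note phi_less = speed_function_strict_antimono[OF assms(2)]
  have one: "\<phi> 1 = 0" using assms(2) by (simp add: speed_function_def)
  interpret bottleneck l Vm Vp \<rho>m \<rho>p L \<phi>
  proof
    show "0 < \<phi> \<rho>p" using phi_less[of \<rho>p 1] one assms by simp
    show "\<phi> b \<le> \<phi> a" if "\<rho>m \<le> a" "a \<le> b" "b \<le> \<rho>p" for a b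
      using phi_less[of a b] that assms by (cases "a = b") auto
    show "\<bar>\<phi> a - \<phi> b\<bar> \<le> L * \<bar>a - b\<bar>" if "a \<in> {\<rho>m..\<rho>p}" "b \<in> {\<rho>m..\<rho>p}" for a b
      using that assms by (intro L(2)) auto
    show "a = \<rho>m" if "a \<in> {\<rho>m..\<rho>p}" "flux Vm \<phi> a = flux Vm \<phi> \<rho>m" for a
      using flux_less[of \<rho>m a] that assms by (cases "a = \<rho>m") auto
  qed (use assms L in auto)
  show ?thesis
    using profile_ex1 unfolding profile_def .
qed

end
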